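(* Let $p_1,\dots,p_6$ and $q_1,\dots,q_6$ be non-negative real numbers with $\sum_{i=1}^6 p_i = 1 = \sum_{j=1}^6 q_j$ (the probabilities that the faces $1,\dots,6$ of two independent dice come up). Suppose that the pair has the same total distribution as a pair of fair dice, i.e. for every integer $t$ with $2\le t\le 12$, $$\sum_{\substack{1\le i,j\le 6\\ i+j=t}} p_i q_j \;=\; \frac{\#\{(i,j)\in\{1,\dots,6\}^2 : i+j=t\}}{36}.$$ Then $p_i = q_i = \frac16$ for all $i\in\{1,\dots,6\}$.
   Context: A six-sided die is fair if each of its faces has probability $\frac16$, and loaded otherwise. The play of the game of craps depends only on the totals showing on two independent six-sided dice; the total distribution of the pair is the list of probabilities of the totals $2,3,\dots,12$. A "fair game of craps" means that the total distribution equals that of two fair dice. *)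

theory Defs
  imports Complex_Main
begin

end

theory Submission
  imports Defs
begin

text \<open>
  Encode a die by the polynomial \<open>P(x) = p\<^sub>1 + p\<^sub>2 x + \<dots> + p\<^sub>6 x\<^sup>5\<close>. The totals of two
  independent dice are the coefficients of the product of their polynomials, so the hypothesis
  says \<open>P Q = G\<^sup>2\<close>, where \<open>G = (1 + x + \<dots> + x\<^sup>5) / 6\<close> belongs to a fair die, and
  \<open>6 G = (1 + x) (1 + x + x\<^sup>2) (1 - x + x\<^sup>2)\<close>. The proof locates the roots of \<open>P\<close> and \<open>Q\<close>
  among the roots of \<open>G\<close>; each root imposes linear conditions on the face probabilities.

  The only real root of \<open>G\<close> is \<open>-1\<close>. Since \<open>p\<^sub>6 q\<^sub>6 = 1/36\<close>, both \<open>P\<close> and \<open>Q\<close> have odd degree and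
  thus a real root, hence both vanish at \<open>-1\<close> (\<open>fair_total_pair_root_minus_one\<close>). At a
  primitive cube root of unity at least one of \<open>P\<close> and \<open>Q\<close> vanishes, and likewise at a primitive sixth root of unity.

  If the same die takes care of both of these roots, it satisfies five independent linear
  conditions besides having total mass 1, which makes it fair (\<open>fair_total_pair_both_balanced\<close>).
  Otherwise the two roots are divided between the dice, say \<open>P\<close> has the cube root and \<open>Q\<close> the sixth
  root. Then \<open>q\<close> has the form \<open>(s\<^sub>0, s\<^sub>1, s\<^sub>2, s\<^sub>0, s\<^sub>1, s\<^sub>2)\<close>, and the extreme totals 2, 3, 11, 12 leave
  \<open>s\<^sub>0 = s\<^sub>1 = s\<^sub>2 = 1/6\<close> as the only non-negative solution
  (\<open>fair_total_pair_mixed_balanced\<close>). Nonnegativity is essential here: the factorization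
  \<open>P = (1 + x) (1 + x + x\<^sup>2)\<^sup>2 / 18\<close>, \<open>Q = (1 + x) (1 - x + x\<^sup>2)\<^sup>2 / 2\<close> also has product \<open>G\<^sup>2\<close>, but
  \<open>Q\<close> has negative coefficients.

  Once one die is known to be fair, the totals 2 to 7 determine the other one face by face.
\<close>

section \<open>Totals and generating functions\<close>

definition total_prob :: "(nat \<Rightarrow> real) \<Rightarrow> (nat \<Rightarrow> real) \<Rightarrow> nat \<Rightarrow> real" where
  "total_prob p q t =
     (\<Sum>(i, j)\<in>{(i, j). i \<in> {1..6} \<and> j \<in> {1..6} \<and> i + j = t}. p i * q j)"

text \<open>
  The probability generating function of the face shown, divided by \<open>x\<close>. This shift makes the
  value at \<open>0\<close> equal to \<open>p 1\<close>, so that \<open>0\<close> is not a root when the totals are fair. The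
  argument ranges over any real field because real roots and complex roots of unity are both needed.
\<close>

definition face_pgf :: "(nat \<Rightarrow> real) \<Rightarrow> 'a::real_field \<Rightarrow> 'a" where
  "face_pgf p x = (\<Sum>i=1..6. of_real (p i) * x ^ (i - 1))"

text \<open>
  The target totals are written as the totals of two constant functions \<open>1/6\<close>, not as
  cardinalities: both sides of \<open>P Q = G\<^sup>2\<close> are then instances of one product formula.
\<close>

definition fair_total_pair :: "(nat \<Rightarrow> real) \<Rightarrow> (nat \<Rightarrow> real) \<Rightarrow> bool" where
  "fair_total_pair p q \<longleftrightarrow>
     (\<forall>i\<in>{1..6}. 0 \<le> p i \<and> 0 \<le> q i) \<and> sum p {1..6} = 1 \<and> sum q {1..6} = 1 \<and>
     (\<forall>t\<in>{2..12}. total_prob p q t = total_prob (\<lambda>_. 1/6) (\<lambda>_. 1/6) t)"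

lemma faces_cases: "(\<forall>i\<in>{1..6::nat}. P i) \<longleftrightarrow> P 1 \<and> P 2 \<and> P 3 \<and> P 4 \<and> P 5 \<and> P 6"
proof -
  have "{1..6::nat} = {1, 2, 3, 4, 5, 6}"
    by auto
  then show ?thesis
    by simp
qed

lemma sum_faces: "(\<Sum>i=1..6::nat. f i) = f 1 + f 2 + f 3 + f 4 + f 5 + (f 6 :: 'a::comm_monoid_add)"
  by (simp add: numeral_eq_Suc ac_simps)

lemma face_pgf_expand:
  "face_pgf p x = of_real (p 1) + of_real (p 2) * x + of_real (p 3) * x^2
     + of_real (p 4) * x^3 + of_real (p 5) * x^4 + of_real (p 6) * x^5"
  unfolding face_pgf_def sum_faces by simp

text \<open>
  With the total \<open>t\<close> fixed, the second face is determined by the first. For a numeral \<open>t\<close> the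
  resulting interval sum evaluates by simplification.
\<close>

lemma total_prob_alt:
  "total_prob p q t = (\<Sum>i=max 1 (t - 6)..min 6 (t - 1). p i * q (t - i))"
  unfolding total_prob_def
  by (rule sum.reindex_bij_witness[of _ "\<lambda>i. (i, t - i)" fst]) auto

lemma total_prob_commute: "total_prob p q t = total_prob q p t"
  unfolding total_prob_def
  by (rule sum.reindex_bij_witness[of _ prod.swap prod.swap]) (auto simp: mult.commute)

lemma fair_total_pair_commute: "fair_total_pair p q \<Longrightarrow> fair_total_pair q p"
  by (auto simp: fair_total_pair_def total_prob_commute[of q p])

text \<open>
  Multiplying out and collecting the pairs of faces with a common total: independence of the
  dice is exactly the Cauchy product.
\<close>

lemma face_pgf_mult:
  "face_pgf p x * face_pgf q x = (\<Sum>t=2..12. of_real (total_prob p q t) * x ^ (t - 2))"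
proof -
  let ?S = "{1..6::nat} \<times> {1..6::nat}"
  let ?g = "\<lambda>(i, j). of_real (p i * q j) * x ^ (i + j - 2)"
  have exponent: "x ^ (i - 1) * x ^ (j - 1) = x ^ (i + j - 2)" if "1 \<le> i" "1 \<le> j" for i j
  proof -
    have "i - 1 + (j - 1) = i + j - 2"
      using that by simp
    then show ?thesis
      by (metis power_add)
  qed
  have "face_pgf p x * face_pgf q x
      = (\<Sum>(i, j)\<in>?S. (of_real (p i) * x ^ (i - 1)) * (of_real (q j) * x ^ (j - 1)))"
    unfolding face_pgf_def by (simp only: sum_product sum.cartesian_product)
  also have "\<dots> = sum ?g ?S"
  proof (rule sum.cong[OF refl])
    fix z assume "z \<in> ?S"
    then obtain i j where z: "z = (i, j)" and ij: "1 \<le> i" "1 \<le> j"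
      by (cases z) auto
    show "(case z of (i, j) \<Rightarrow> of_real (p i) * x ^ (i - 1) * (of_real (q j) * x ^ (j - 1))) = ?g z"
      unfolding z prod.case exponent[OF ij, symmetric] of_real_mult by (simp only: ac_simps)
  qed
  also have "\<dots> = (\<Sum>t=2..12. sum ?g {z \<in> ?S. fst z + snd z = t})"
    by (rule sum.group[symmetric]) auto
  also have "\<dots> = (\<Sum>t=2..12. of_real (total_prob p q t) * x ^ (t - 2))"
  proof (intro sum.cong refl)
    fix t :: nat
    have "{z \<in> ?S. fst z + snd z = t} = {(i, j). i \<in> {1..6} \<and> j \<in> {1..6} \<and> i + j = t}"
      by auto
    then show "sum ?g {z \<in> ?S. fst z + snd z = t} = of_real (total_prob p q t) * x ^ (t - 2)"
      unfolding total_prob_def of_real_sum sum_distrib_right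
    proof (rule sum.cong)
      fix z assume "z \<in> {(i, j). i \<in> {1..6} \<and> j \<in> {1..6} \<and> i + j = t}"
      then show "?g z = of_real (case z of (i, j) \<Rightarrow> p i * q j) * x ^ (t - 2)"
        by (cases z) simp
    qed
  qed
  finally show ?thesis .
qed

lemma face_pgf_fair_total_pair:
  assumes "fair_total_pair p q"
  shows "face_pgf p x * face_pgf q x = (face_pgf (\<lambda>_. 1/6) x)\<^sup>2"
  using assms unfolding power2_eq_square face_pgf_mult fair_total_pair_def
  by (intro sum.cong refl) simp

text \<open>The factorization into cyclotomic polynomials, which exhibits the roots to be distributed.\<close>

lemma face_pgf_fair:
  "6 * face_pgf (\<lambda>_. 1/6) x = (1 + x) * (1 + x + x\<^sup>2) * (1 - x + x\<^sup>2)"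
  unfolding face_pgf_expand by (simp add: field_simps power2_eq_square eval_nat_numeral)

lemma fair_total_pair_equations:
  assumes "fair_total_pair p q"
  shows "p 1 * q 1 = 1/36"
    and "p 1 * q 2 + p 2 * q 1 = 2/36"
    and "p 1 * q 3 + p 2 * q 2 + p 3 * q 1 = 3/36"
    and "p 1 * q 4 + p 2 * q 3 + p 3 * q 2 + p 4 * q 1 = 4/36"
    and "p 1 * q 5 + p 2 * q 4 + p 3 * q 3 + p 4 * q 2 + p 5 * q 1 = 5/36"
    and "p 1 * q 6 + p 2 * q 5 + p 3 * q 4 + p 4 * q 3 + p 5 * q 2 + p 6 * q 1 = 6/36"
    and "p 5 * q 6 + p 6 * q 5 = 2/36"
    and "p 6 * q 6 = 1/36"
proof -
  have eq: "total_prob p q t = total_prob (\<lambda>_. 1/6) (\<lambda>_. 1/6) t" if "t \<in> {2..12}" for t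
    using assms that by (simp add: fair_total_pair_def)
  show "p 1 * q 1 = 1/36"
    using eq[of 2] by (simp add: total_prob_alt numeral_eq_Suc)
  show "p 1 * q 2 + p 2 * q 1 = 2/36"
    using eq[of 3] by (simp add: total_prob_alt numeral_eq_Suc)
  show "p 1 * q 3 + p 2 * q 2 + p 3 * q 1 = 3/36"
    using eq[of 4] by (simp add: total_prob_alt numeral_eq_Suc)
  show "p 1 * q 4 + p 2 * q 3 + p 3 * q 2 + p 4 * q 1 = 4/36"
    using eq[of 5] by (simp add: total_prob_alt numeral_eq_Suc)
  show "p 1 * q 5 + p 2 * q 4 + p 3 * q 3 + p 4 * q 2 + p 5 * q 1 = 5/36"
    using eq[of 6] by (simp add: total_prob_alt numeral_eq_Suc)
  show "p 1 * q 6 + p 2 * q 5 + p 3 * q 4 + p 4 * q 3 + p 5 * q 2 + p 6 * q 1 = 6/36"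
    using eq[of 7] by (simp add: total_prob_alt numeral_eq_Suc)
  show "p 5 * q 6 + p 6 * q 5 = 2/36"
    using eq[of 11] by (simp add: total_prob_alt numeral_eq_Suc)
  show "p 6 * q 6 = 1/36"
    using eq[of 12] by (simp add: total_prob_alt numeral_eq_Suc)
qed

section \<open>The real root\<close>

text \<open>
  A polynomial of odd degree has a real root. An explicit bound for it is available: at
  \<open>x = - 1 / p 6\<close> the leading term is \<open>- x\<^sup>4\<close>, and as \<open>\<bar>x\<bar> \<ge> 1\<close> it is in size at least
  the contribution of the even powers, whose coefficients sum to at most 1; the other odd powers are not positive.
\<close>

lemma face_pgf_real_root_exists:
  fixes p :: "nat \<Rightarrow> real"
  assumes nonneg: "\<forall>i\<in>{1..6}. 0 \<le> p i" and sum1: "sum p {1..6} = 1" and p6: "0 < p 6"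
  shows "\<exists>x. face_pgf p (x::real) = 0"
proof -
  define M where "M = 1 / p 6"
  have p: "0 \<le> p 1" "0 \<le> p 2" "0 \<le> p 3" "0 \<le> p 4" "0 \<le> p 5" "0 \<le> p 6"
    using nonneg by auto
  have s: "p 1 + p 2 + p 3 + p 4 + p 5 + p 6 = 1"
    using sum1 unfolding sum_faces .
  have M: "1 \<le> M" "p 6 * M = 1"
    using p6 s p by (auto simp: M_def field_simps)
  have "face_pgf p (- M)
      = p 1 + p 3 * M^2 + p 5 * M^4 - (p 6 * M) * M^4 - (p 2 * M + p 4 * M^3)"
    unfolding face_pgf_expand by (simp add: eval_nat_numeral algebra_simps)
  also have "\<dots> \<le> p 1 * M^4 + p 3 * M^4 + p 5 * M^4 - 1 * M^4 - 0"
    unfolding M(2) using M(1) p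
    by (intro add_mono diff_mono mult_left_mono order.refl power_increasing add_nonneg_nonneg)
       (simp_all add: mult_left_le one_le_power mult_le_cancel_left1)
  also have "\<dots> = (p 1 + p 3 + p 5 - 1) * M^4"
    by (simp add: algebra_simps)
  also have "\<dots> \<le> 0"
    using p s M(1) by (intro mult_nonpos_nonneg) auto
  finally have left: "face_pgf p (- M) \<le> 0" .
  have right: "0 \<le> face_pgf p (0::real)"
    using p by (simp add: face_pgf_expand)
  have "continuous_on {- M..0} (face_pgf p :: real \<Rightarrow> real)"
    unfolding face_pgf_def by (intro continuous_intros)
  then show ?thesis
    using IVT'[of "face_pgf p" "- M" 0 0] left right M(1) by fastforce
qed

text \<open>
  The real root of \<open>P\<close> is a root of \<open>G\<close>, and \<open>-1\<close> is the only real one. The conclusion is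
  \<open>P(-1) = 0\<close>; in terms of the die, even and odd faces are equally likely.
\<close>

lemma fair_total_pair_root_minus_one:
  assumes "fair_total_pair p q"
  shows "p 1 + p 3 + p 5 = p 2 + p 4 + p 6"
proof -
  have "p 6 \<noteq> 0"
    using fair_total_pair_equations(8)[OF assms] by auto
  moreover have "0 \<le> p 6"
    using assms by (simp add: fair_total_pair_def)
  ultimately obtain x :: real where root: "face_pgf p x = 0"
    using face_pgf_real_root_exists[of p] assms by (auto simp: fair_total_pair_def)
  then have "face_pgf (\<lambda>_. 1/6) x = 0"
    using face_pgf_fair_total_pair[OF assms, of x] by simp
  then have zero: "(1 + x) * (1 + x + x\<^sup>2) * (1 - x + x\<^sup>2) = 0"
    using face_pgf_fair[of x] by simp
  have "1 + x + x\<^sup>2 = (x + 1/2)\<^sup>2 + 3/4" "1 - x + x\<^sup>2 = (x - 1/2)\<^sup>2 + 3/4"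
    by (simp_all add: power2_eq_square algebra_simps)
  then have "1 + x + x\<^sup>2 > 0" "1 - x + x\<^sup>2 > 0"
    by (simp_all add: add_nonneg_pos)
  with zero have "x = -1"
    by auto
  with root show ?thesis
    by (simp add: face_pgf_expand)
qed

section \<open>The primitive cube and sixth roots of unity\<close>

lemma real_combination_nonreal:
  assumes "complex_of_real a + of_real b * w = 0" "Im w \<noteq> 0"
  shows "a = 0" "b = 0"
proof -
  from assms show "b = 0"
    by (simp add: complex_eq_iff)
  with assms show "a = 0"
    by simp
qed

text \<open>
  Modulo \<open>1 + w + w\<^sup>2\<close> the powers of \<open>w\<close> have period 3, so \<open>P(w)\<close> sees only the masses of the three
  residue classes of faces modulo 3; it vanishes just when these are equal.
\<close>

lemma face_pgf_cube_root:
  fixes w :: complex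
  assumes w: "1 + w + w\<^sup>2 = 0" "Im w \<noteq> 0" and zero: "face_pgf p w = 0"
  shows "p 1 + p 4 = p 2 + p 5" "p 2 + p 5 = p 3 + p 6"
proof -
  have w2: "w^2 = - 1 - w"
    using w(1) by (simp add: eq_neg_iff_add_eq_0 algebra_simps)
  have w3: "w^3 = 1" 
    using w2 by algebra
  have w4: "w^4 = w" "w^5 = - 1 - w"
    using w2 w3 by algebra+
  have "complex_of_real (p 1 + p 4 - (p 3 + p 6)) + of_real (p 2 + p 5 - (p 3 + p 6)) * w = 0"
    using zero unfolding face_pgf_expand w2 w3 w4 by (simp add: algebra_simps)
  from real_combination_nonreal[OF this w(2)]
  show "p 1 + p 4 = p 2 + p 5" "p 2 + p 5 = p 3 + p 6" by auto
qed

text \<open>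
  Here \<open>w\<^sup>3 = -1\<close>, so opposite powers enter with opposite signs and \<open>P(w)\<close> sees only the
  differences \<open>p i - p (i + 3)\<close>.
\<close>

lemma face_pgf_sixth_root:
  fixes w :: complex
  assumes w: "1 - w + w\<^sup>2 = 0" "Im w \<noteq> 0" and zero: "face_pgf p w = 0"
  shows "p 1 - p 4 = p 3 - p 6" "p 5 - p 2 = p 3 - p 6"
proof -
  have w2: "w^2 = w - 1"
    using w(1) by (simp add: eq_neg_iff_add_eq_0 algebra_simps)
  have w3: "w^3 = - 1" 
    using w2 by algebra
  have w4: "w^4 = - w" "w^5 = 1 - w"
    using w2 w3 by algebra+
  have "complex_of_real (p 1 - p 4 - (p 3 - p 6)) + of_real (p 2 - p 5 + (p 3 - p 6)) * w = 0"
    using zero unfolding face_pgf_expand w2 w3 w4 by (simp add: algebra_simps)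
  from real_combination_nonreal[OF this w(2)]
  show "p 1 - p 4 = p 3 - p 6" "p 5 - p 2 = p 3 - p 6" by auto
qed

text \<open>
  These predicates are the linear forms of divisibility of \<open>P\<close> by \<open>1 + x + x\<^sup>2\<close> and by
  \<open>1 - x + x\<^sup>2\<close>.
\<close>

definition cube_balanced :: "(nat \<Rightarrow> real) \<Rightarrow> bool" where
  "cube_balanced p \<longleftrightarrow> p 1 + p 4 = p 2 + p 5 \<and> p 2 + p 5 = p 3 + p 6"

definition sixth_balanced :: "(nat \<Rightarrow> real) \<Rightarrow> bool" where
  "sixth_balanced p \<longleftrightarrow> p 1 - p 4 = p 3 - p 6 \<and> p 5 - p 2 = p 3 - p 6"

lemma fair_total_pair_cube_balanced:
  assumes "fair_total_pair p q"
  shows "cube_balanced p \<or> cube_balanced q"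
proof -
  define w where "w = Complex (- 1/2) (sqrt 3 / 2)"
  have w: "1 + w + w\<^sup>2 = 0" "Im w \<noteq> 0"
    by (simp_all add: w_def complex_eq_iff power2_eq_square field_simps)
  have "6 * face_pgf (\<lambda>_. 1/6) w = 0"
    unfolding face_pgf_fair using w by simp
  then have "face_pgf p w = 0 \<or> face_pgf q w = 0"
    using face_pgf_fair_total_pair[OF assms, of w] by auto
  then show ?thesis
    unfolding cube_balanced_def using face_pgf_cube_root[OF w] by blast
qed

lemma fair_total_pair_sixth_balanced:
  assumes "fair_total_pair p q"
  shows "sixth_balanced p \<or> sixth_balanced q"
proof -
  define w where "w = Complex (1/2) (sqrt 3 / 2)"
  have w: "1 - w + w\<^sup>2 = 0" "Im w \<noteq> 0"
    by (simp_all add: w_def complex_eq_iff power2_eq_square field_simps)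
  have "6 * face_pgf (\<lambda>_. 1/6) w = 0"
    unfolding face_pgf_fair using w by simp
  then have "face_pgf p w = 0 \<or> face_pgf q w = 0"
    using face_pgf_fair_total_pair[OF assms, of w] by auto
  then show ?thesis
    unfolding sixth_balanced_def using face_pgf_sixth_root[OF w] by blast
qed

section \<open>Distribution of the roots between the dice\<close>

text \<open>
  The equation for the total \<open>k + 1\<close> gives \<open>q k\<close> once \<open>q 1, \<dots>, q (k - 1)\<close> are known.
\<close>

lemma fair_total_pair_other_fair:
  assumes pair: "fair_total_pair p q" and fair: "\<forall>i\<in>{1..6}. p i = 1/6"
  shows "\<forall>i\<in>{1..6}. q i = 1/6"
  using fair_total_pair_equations[OF pair] fair unfolding faces_cases
  by (simp del: One_nat_def)

text \<open>In this case \<open>P\<close> vanishes at all five roots of \<open>G\<close>, so it is a multiple of \<open>G\<close>.\<close>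

lemma fair_total_pair_both_balanced:
  assumes pair: "fair_total_pair p q" and "cube_balanced p" "sixth_balanced p"
  shows "\<forall>i\<in>{1..6}. p i = 1/6"
proof -
  have "p 1 + p 2 + p 3 + p 4 + p 5 + p 6 = 1"
    using pair unfolding fair_total_pair_def sum_faces by blast
  then show ?thesis
    using fair_total_pair_root_minus_one[OF pair] assms(2,3)
    unfolding faces_cases cube_balanced_def sixth_balanced_def by linarith
qed

text \<open>
  Here \<open>Q\<close> is divisible by \<open>(1 + x) (1 - x + x\<^sup>2) = 1 + x\<^sup>3\<close>, so that \<open>q\<close> has period 3, while
  \<open>P\<close> is left with the two parameters \<open>p 1\<close> and \<open>p 6\<close>. The totals 2 and 12 express these through
  \<open>q\<close>, and the totals 3 and 11 then become two polynomial equations in \<open>s0\<close> and \<open>s2\<close> that are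
  exchanged by swapping the two variables.
\<close>

lemma fair_total_pair_mixed_balanced:
  assumes pair: "fair_total_pair p q" and p: "cube_balanced p" and q: "sixth_balanced q"
  shows "\<forall>i\<in>{1..6}. q i = 1/6"
proof -
  define a c s0 s1 s2 where defs: "a = p 1" "c = p 6" "s0 = q 1" "s1 = q 2" "s2 = q 3"
  have nonneg: "0 \<le> s0" "0 \<le> s1" "0 \<le> s2" and
    sums: "p 1 + p 2 + p 3 + p 4 + p 5 + p 6 = 1" "q 1 + q 2 + q 3 + q 4 + q 5 + q 6 = 1"
    using pair unfolding fair_total_pair_def sum_faces faces_cases defs by blast+
  have q4: "q 4 = s0" "q 5 = s1" "q 6 = s2"
    using q fair_total_pair_root_minus_one[OF fair_total_pair_commute[OF pair]]
    unfolding sixth_balanced_def defs by linarith+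
  have half: "s1 = 1/2 - s0 - s2"
    using sums(2) q4 by (simp add: defs)
  have p2: "p 2 = 1/6 + a - c" "p 5 = 1/6 - a + c"
    using p sums(1) fair_total_pair_root_minus_one[OF pair]
    unfolding cube_balanced_def defs by linarith+
  note eqs = fair_total_pair_equations[OF pair, folded defs, unfolded q4 p2, folded defs]
  have a: "36 * (a * s0) = 1" and c: "36 * (c * s2) = 1"
    using eqs(1,8) by simp_all
  have e3: "a * s1 + (1/6 + a - c) * s0 = 1/18" and e11: "(1/6 - a + c) * s2 + c * s1 = 1/18"
    using eqs(2,7) by simp_all
  \<comment> \<open>Multiplying by \<open>36 s\<^sub>0 s\<^sub>2\<close> clears the denominators of \<open>a = 1 / (36 s\<^sub>0)\<close> and \<open>c = 1 / (36 s\<^sub>2)\<close>.\<close>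
  have E1: "s2 * (s1 - s0) = s0\<^sup>2 - 6 * s0\<^sup>2 * s2"
  proof -
    have "36 * s0 * s2 * (a * s1 + (1/6 + a - c) * s0)
        = 36 * (a * s0) * (s1 * s2 + s0 * s2) - 36 * (c * s2) * s0\<^sup>2 + 6 * s0\<^sup>2 * s2"
      by (simp add: algebra_simps power2_eq_square)
    then show ?thesis
      unfolding a c e3 by (simp add: algebra_simps)
  qed
  have E2: "s0 * (s1 - s2) = s2\<^sup>2 - 6 * s2\<^sup>2 * s0"
  proof -
    have "36 * s0 * s2 * ((1/6 - a + c) * s2 + c * s1)
        = 36 * (c * s2) * (s0 * s1 + s0 * s2) - 36 * (a * s0) * s2\<^sup>2 + 6 * s2\<^sup>2 * s0"
      by (simp add: algebra_simps power2_eq_square)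
    then show ?thesis
      unfolding a c e11 by (simp add: algebra_simps)
  qed
  \<comment> \<open>The difference of the two equations; its second factor is excluded by the inequality between
    arithmetic and geometric means, as \<open>s\<^sub>0 + s\<^sub>2 \<le> 1/2\<close>.\<close>
  have "(s0 - s2) * (1/2 - 6 * s0 * s2) = 0"
    using E1 E2 half by algebra
  moreover have "s0 * s2 \<le> 1/16"
  proof -
    have "(s0 + s2)\<^sup>2 \<le> (1/2)\<^sup>2"
      using nonneg half by (intro power_mono) auto
    then have "(s0 + s2)\<^sup>2 \<le> 1/4"
      by (simp add: power_divide)
    moreover have "4 * (s0 * s2) = (s0 + s2)\<^sup>2 - (s0 - s2)\<^sup>2"
      by (simp add: power2_eq_square algebra_simps)
    ultimately show ?thesis
      using zero_le_power2[of "s0 - s2"] by linarith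
  qed
  ultimately have sym: "s2 = s0"
    by auto
  have "s0 > 0"
    using a nonneg(1) by (cases "s0 = 0") auto
  have "s0 * ((6 * s0 - 1) * (2 * s0 - 1)) = 0"
    using E1 half sym by algebra
  \<comment> \<open>The root \<open>1/2\<close> would give \<open>s\<^sub>1 = -1/2\<close>; it belongs to the factorization with a negative
    coefficient.\<close>
  moreover have "s0 \<noteq> 1/2"
    using half sym nonneg by auto
  ultimately have "s0 = 1/6"
    using \<open>s0 > 0\<close> by auto
  then show ?thesis
    using half sym q4 unfolding faces_cases by (simp add: defs)
qed

section \<open>A fair pair consists of fair dice\<close>

theorem proposition2p1p4:
  fixes p q :: "nat \<Rightarrow> real"
  assumes p_nonneg: "\<forall>i\<in>{1..6}. 0 \<le> p i"
    and q_nonneg: "\<forall>j\<in>{1..6}. 0 \<le> q j"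
    and p_sum: "(\<Sum>i=1..6. p i) = 1"
    and q_sum: "(\<Sum>j=1..6. q j) = 1"
    and same_totals: "\<forall>t\<in>{2..12}.
      (\<Sum>(i, j)\<in>{(i, j). i \<in> {1..6} \<and> j \<in> {1..6} \<and> i + j = t}. p i * q j)
        = real (card {(i, j). i \<in> {1..6::nat} \<and> j \<in> {1..6::nat} \<and> i + j = t}) / 36"
  shows "\<forall>i\<in>{1..6}. p i = 1 / 6 \<and> q i = 1 / 6"
proof -
  have "total_prob p q t = total_prob (\<lambda>_. 1/6) (\<lambda>_. 1/6) t" if "t \<in> {2..12}" for t
    using same_totals that by (simp add: total_prob_def split_def)
  then have pair: "fair_total_pair p q"
    using assms by (simp add: fair_total_pair_def)
  note swapped = fair_total_pair_commute[OF pair]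
  have "(\<forall>i\<in>{1..6}. p i = 1/6) \<or> (\<forall>i\<in>{1..6}. q i = 1/6)"
    using fair_total_pair_cube_balanced[OF pair] fair_total_pair_sixth_balanced[OF pair]
      fair_total_pair_both_balanced[OF pair] fair_total_pair_both_balanced[OF swapped]
      fair_total_pair_mixed_balanced[OF pair] fair_total_pair_mixed_balanced[OF swapped]
    by blast
  then show ?thesis
    using fair_total_pair_other_fair[OF pair] fair_total_pair_other_fair[OF swapped] by blast
qed

end
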